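(* Let $a>1$ be an integer, $p$ a prime, and $M_p^{(a)}=\frac{a^p-1}{a-1}$. If $\gcd(M_p^{(a)},a-1)=1$, then $M_p^{(a)}$ is either prime or an overpseudoprime to base $a$.
   Context: For an integer $m>1$ with $\gcd(m,a)=1$, $h_a(m)$ denotes the multiplicative order of $a$ modulo $m$. The cyclotomic cosets of $a$ modulo $m$ are the orbits of $\{1,2,\ldots,m-1\}$ under $x\mapsto ax\bmod m$; $r_a(m)$ denotes their number. An odd composite number $n$ with $\gcd(n,a)=1$ is called an overpseudoprime to base $a$ if $n=r_a(n)h_a(n)+1$. *)

theory Defs
  imports "HOL-Number_Theory.Number_Theory" "HOL-Combinatorics.Orbits"
begin

text \<open>
  The library's \<^const>\<open>orbit\<close> of \<open>x\<close> under \<open>f\<close> consists of \<open>f x, f (f x), \<dots>\<close>.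
  If \<open>a\<close> is coprime to \<open>m\<close>, then \<open>x \<mapsto> a * x mod m\<close> permutes \<open>{1..m-1}\<close>, so \<open>x\<close> lies in
  its own orbit and the orbits partition \<open>{1..m-1}\<close>.
\<close>

definition cyclotomic_cosets :: "nat \<Rightarrow> nat \<Rightarrow> nat set set" where
  "cyclotomic_cosets a m = orbit (\<lambda>x. a * x mod m) ` {1..m-1}"

definition num_cyclotomic_cosets :: "nat \<Rightarrow> nat \<Rightarrow> nat" where
  "num_cyclotomic_cosets a m = card (cyclotomic_cosets a m)"

definition overpseudoprime :: "nat \<Rightarrow> nat \<Rightarrow> bool" where
  "overpseudoprime a n \<longleftrightarrow>
     odd n \<and> n > 1 \<and> \<not> prime n \<and> coprime n a \<and>
     n = num_cyclotomic_cosets a n * ord n a + 1"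

text \<open>The division below is exact for \<open>a > 1\<close>.\<close>

definition gen_mersenne :: "nat \<Rightarrow> nat \<Rightarrow> nat" where
  "gen_mersenne a p = (a ^ p - 1) div (a - 1)"

end

theory Submission
  imports Defs
begin

text \<open>
  Let \<open>M = (a ^ p - 1) div (a - 1)\<close>. If \<open>d > 1\<close> divides \<open>M\<close>, then \<open>a ^ p\<close> is \<open>1\<close> modulo \<open>d\<close>, so
  \<open>a\<close> has order \<open>1\<close> or \<open>p\<close> modulo \<open>d\<close>; order \<open>1\<close> would make \<open>d\<close> a common divisor of \<open>M\<close> and
  \<open>a - 1\<close>. The coset of \<open>x\<close> modulo \<open>M\<close> has as many elements as the order of \<open>a\<close> modulo
  \<open>M div gcd x M\<close>, so all cosets have exactly \<open>p\<close> elements.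
\<close>

text \<open>The factor \<open>gcd x m\<close> can be pulled out of both residues; what is left of
  \<open>x\<close> is coprime to what is left of \<open>m\<close> and therefore cancels.\<close>

lemma cong_mult_rcancel_gcd_nat:
  fixes b c m x :: nat
  assumes "m > 0"
  shows "[b * x = c * x] (mod m) \<longleftrightarrow> [b = c] (mod (m div gcd x m))"
proof -
  define g where "g = gcd x m"
  have g: "g > 0" using assms by (simp add: g_def)
  obtain y d where xy: "x = y * g" "m = d * g" "coprime y d"
    using gcd_coprime_exists[of x m, folded g_def] g by blast
  have "[b * x = c * x] (mod m) \<longleftrightarrow> g * (b * y mod d) = g * (c * y mod d)"
    unfolding cong_def xy mult_mod_right by (simp add: ac_simps)
  also have "\<dots> \<longleftrightarrow> [b * y = c * y] (mod d)"
    using g by (simp add: cong_def)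
  also have "\<dots> \<longleftrightarrow> [b = c] (mod d)"
    using xy(3) by (rule cong_mult_rcancel_nat)
  also have "d = m div gcd x m" using g xy(2) unfolding g_def[symmetric] by simp
  finally show ?thesis .
qed

lemma funpow_mult_mod:
  fixes a m x :: nat
  assumes "x < m"
  shows "((\<lambda>x. a * x mod m) ^^ i) x = a ^ i * x mod m"
  using assms by (induction i) (simp_all add: mod_mult_right_eq mult.assoc)

lemma coprime_div_gcd:
  fixes a m x :: nat
  assumes "coprime a m"
  shows "coprime (m div gcd x m) a"
proof -
  have "m div gcd x m dvd m" by (metis dvd_div_mult_self dvd_triv_left gcd_dvd2)
  then show ?thesis
    using assms by (meson coprime_commute coprime_divisors dvd_refl)
qed

text \<open>Cancelling \<open>x\<close> from \<open>a ^ i * x\<close> and \<open>a ^ j * x\<close>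
  leaves two powers of \<open>a\<close> modulo \<open>m div gcd x m\<close>, which agree exactly
  when their exponents agree modulo the order there.\<close>

lemma funpow_mult_mod_eq_iff:
  fixes a m x :: nat
  assumes "coprime a m" "x < m"
  shows "((\<lambda>x. a * x mod m) ^^ i) x = ((\<lambda>x. a * x mod m) ^^ j) x \<longleftrightarrow>
    [i = j] (mod ord (m div gcd x m) a)"
  using assms cong_mult_rcancel_gcd_nat[of m "a ^ i" x "a ^ j"] coprime_div_gcd[OF assms(1), of x]
  by (simp add: funpow_mult_mod order_divides_expdiff flip: cong_def)

lemma orbit_mult_mod:
  fixes a m x :: nat
  assumes "coprime a m" "x < m"
  defines "f \<equiv> \<lambda>x. a * x mod m" and "k \<equiv> ord (m div gcd x m) a"
  shows "x \<in> orbit f x" "card (orbit f x) = k"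
proof -
  have k: "k > 0"
    using coprime_div_gcd[OF assms(1), of x] by (simp add: k_def coprime_ord)
  note eq_iff = funpow_mult_mod_eq_iff[OF assms(1,2), folded f_def k_def]
  have period: "(f ^^ k) x = x"
    using eq_iff[of k 0] by (simp add: cong_def)
  \<comment> \<open>An orbit starts at \<open>f x\<close>, so \<open>x\<close> has to be reached by
    a positive number of steps, here \<open>k\<close>.\<close>
  then show "x \<in> orbit f x"
    using k by (force simp: orbit_altdef)
  have "orbit f x = (\<lambda>i. (f ^^ i) x) ` {..<k}"
    using orbit_altdef_bounded[OF period k] by auto
  \<comment> \<open>Exponents below \<open>k\<close> that are congruent modulo \<open>k\<close> are
    equal, so the first \<open>k\<close> iterates do not repeat.\<close>
  moreover have "inj_on (\<lambda>i. (f ^^ i) x) {..<k}"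
    by (rule inj_onI) (auto simp: eq_iff cong_def)
  ultimately show "card (orbit f x) = k" by (simp add: card_image)
qed

lemma orbit_mult_mod_subset:
  fixes a m x :: nat
  assumes "coprime a m" "x \<in> {1..m-1}"
  shows "orbit (\<lambda>x. a * x mod m) x \<subseteq> {1..m-1}"
proof
  have step: "a * y mod m \<in> {1..m-1}" if "y \<in> {1..m-1}" for y
  proof -
    have "m > 0" "\<not> m dvd y" using that by (auto dest: dvd_imp_le)
    \<comment> \<open>Coprimality keeps the iteration away from \<open>0\<close>.\<close>
    then have "\<not> m dvd a * y"
      using assms(1) by (metis coprime_commute coprime_dvd_mult_right_iff)
    then have "a * y mod m > 0" by (simp add: mod_greater_zero_iff_not_dvd)
    moreover have "a * y mod m < m" using \<open>m > 0\<close> by simp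
    ultimately show ?thesis by simp
  qed
  fix y assume "y \<in> orbit (\<lambda>x. a * x mod m) x"
  then show "y \<in> {1..m-1}"
    by induction (use assms(2) step in blast)+
qed

text \<open>The cosets partition \<open>{1..m-1}\<close>, and the assumption on orders gives each of
  them \<open>k\<close> elements.\<close>

lemma num_cyclotomic_cosets_mult_card:
  assumes "coprime a m"
    and card: "\<And>x. x \<in> {1..m-1} \<Longrightarrow> ord (m div gcd x m) a = k"
  shows "k * num_cyclotomic_cosets a m = m - 1"
proof -
  define f where "f = (\<lambda>x. a * x mod m)"
  define C where "C = cyclotomic_cosets a m"
  have C: "C = orbit f ` {1..m-1}" by (simp add: C_def cyclotomic_cosets_def f_def)
  have self: "x \<in> orbit f x" and k: "card (orbit f x) = k" and
    sub: "orbit f x \<subseteq> {1..m-1}" if "x \<in> {1..m-1}" for x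
    using that orbit_mult_mod[OF assms(1), of x] card[OF that] orbit_mult_mod_subset[OF assms(1) that]
    by (auto simp: f_def)
  \<comment> \<open>As \<open>x\<close> lies in its own orbit, \<open>f\<close> is cyclic there and
    every point generates the same orbit; so cosets that meet coincide.\<close>
  have eq: "orbit f y = orbit f x" if "x \<in> {1..m-1}" "y \<in> orbit f x" for x y
    using orbit_cyclic_eq3[of f "orbit f x" y] cyclic_on_singleI[OF self[OF that(1)] refl] that by simp
  have union: "\<Union> C = {1..m-1}" using self sub unfolding C by blast
  have "k * card C = card (\<Union> C)"
  proof (rule card_partition)
    show "finite C" by (simp add: C)
    show "finite (\<Union> C)" by (simp add: union)
    show "card c = k" if "c \<in> C" for c using that k by (auto simp: C)
    show "c1 \<inter> c2 = {}" if "c1 \<in> C" "c2 \<in> C" "c1 \<noteq> c2" for c1 c2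
      using that eq unfolding C by blast
  qed
  then show ?thesis unfolding union by (simp add: num_cyclotomic_cosets_def C_def)
qed

lemma overpseudoprimeI:
  assumes "odd n" "n > 1" "\<not> prime n" "coprime n a"
    and "\<And>d. d dvd n \<Longrightarrow> d > 1 \<Longrightarrow> ord d a = k"
  shows "overpseudoprime a n"
proof -
  have "ord (n div gcd x n) a = k" if "x \<in> {1..n-1}" for x
  proof (rule assms(5))
    have n: "n = n div gcd x n * gcd x n" by simp
    then show "n div gcd x n dvd n" by (metis dvd_triv_left)
    \<comment> \<open>The gcd is a proper divisor of \<open>n\<close>, so the quotient is a divisor
      other than 1.\<close>
    have "gcd x n \<le> x" "x < n" using that by (auto intro: gcd_le1_nat)
    then have "n div gcd x n \<noteq> 1" using n by (metis leD mult_1)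
    moreover have "n div gcd x n \<noteq> 0" using n assms(2) by (metis mult_0 not_less0)
    ultimately show "n div gcd x n > 1" by linarith
  qed
  then have "k * num_cyclotomic_cosets a n = n - 1"
    using assms(4) by (intro num_cyclotomic_cosets_mult_card) (auto simp: coprime_commute)
  moreover have "ord n a = k" using assms(2,5) by simp
  ultimately show ?thesis
    using assms(1-4) by (simp add: overpseudoprime_def mult.commute)
qed

lemma gen_mersenne_mult:
  assumes "a > 1"
  shows "gen_mersenne a p * (a - 1) = a ^ p - 1"
proof -
  have "[a ^ p = 1 ^ p] (mod (a - 1))"
    using assms by (intro cong_pow) (simp add: cong_altdef_nat)
  then have "a - 1 dvd a ^ p - 1"
    using assms by (simp add: cong_altdef_nat)
  then show ?thesis by (simp add: gen_mersenne_def)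
qed

lemma ord_dvd_gen_mersenne:
  assumes "a > 1" "prime p" "coprime (gen_mersenne a p) (a - 1)"
    and "d dvd gen_mersenne a p" "d > 1"
  shows "ord d a = p"
proof -
  have "d dvd a ^ p - 1"
    using assms(4) gen_mersenne_mult[OF assms(1), of p] by (metis dvd_mult2)
  then have "ord d a dvd p"
    using assms(1) by (simp add: cong_altdef_nat flip: ord_divides)
  moreover have "ord d a \<noteq> 1"
  proof
    assume "ord d a = 1"
    then have "[a ^ 1 = 1] (mod d)" by (metis ord)
    then have "d dvd a - 1"
      using assms(1) by (simp add: cong_altdef_nat)
    with assms(3,4) have "is_unit d" by (rule coprime_common_divisor)
    with assms(5) show False by simp
  qed
  ultimately show ?thesis using assms(2) by (auto simp: prime_nat_iff)
qed

text \<open>If the quotient were even, coprimality would make \<open>a - 1\<close> odd and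
  \<open>a\<close> even, so \<open>a ^ p - 1\<close> would be an odd multiple of an even
  number.\<close>

lemma odd_gen_mersenne:
  assumes "a > 1" "prime p" "coprime (gen_mersenne a p) (a - 1)"
  shows "odd (gen_mersenne a p)"
proof
  assume even: "even (gen_mersenne a p)"
  have "odd (a - 1)"
    using assms(3) even by (metis coprime_common_divisor odd_one)
  then have "even (a ^ p)" using assms(1,2) by (simp add: prime_gt_0_nat)
  then have "odd (a ^ p - 1)" using assms(1) by simp
  then show False using even gen_mersenne_mult[OF assms(1), of p] by (metis even_mult_iff)
qed

theorem theorem9:
  fixes a p :: nat
  assumes "a > 1" and "prime p"
    and "gcd (gen_mersenne a p) (a - 1) = 1"
  shows "prime (gen_mersenne a p) \<or> overpseudoprime a (gen_mersenne a p)"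
proof (rule disjCI)
  let ?M = "gen_mersenne a p"
  assume not_overpseudoprime: "\<not> overpseudoprime a ?M"
  have cop: "coprime ?M (a - 1)" using assms(3) by (simp only: coprime_iff_gcd_eq_1)
  have "a - 1 < a ^ p - 1"
    using power_strict_increasing[of 1 p a] prime_gt_1_nat[OF assms(2)] assms(1) by simp
  then have "?M * (a - 1) > 1 * (a - 1)"
    unfolding gen_mersenne_mult[OF assms(1)] by simp
  then have M: "?M > 1" unfolding mult_less_cancel2 by blast
  note ord = ord_dvd_gen_mersenne[OF assms(1,2) cop]
  \<comment> \<open>\<open>ord\<close> takes the value 0 when the arguments are not coprime, but
    here it is \<open>p > 0\<close>.\<close>
  have "coprime ?M a"
    using ord[OF dvd_refl M] prime_gt_0_nat[OF assms(2)] ord_eq_0[of ?M a] by auto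
  then show "prime ?M"
    using overpseudoprimeI[OF odd_gen_mersenne[OF assms(1,2) cop] M _ _ ord] not_overpseudoprime
    by blast
qed

end
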